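(* Let $S$ be a finite set, and let $L$ be a lattice that is a meet subsemilattice of the partition lattice $\Pi_S$. If $x\in S$ and the partition $m=\{x\}\,\vert\,(S\setminus\{x\})$ belongs to $L$, then $m$ is a left-modular coatom of $L$.
   Context: $\Pi_S$ is the lattice of set partitions of $S$ ordered by refinement (finer partitions are smaller). An element $m$ of a lattice $L$ is left-modular if $(x\vee m)\wedge y=x\vee(m\wedge y)$ for all $x<y$ in $L$. A meet subsemilattice is a subset closed under the meet of $\Pi_S$.
   Formalization: Left-modularity of m is proved as stated; that m is a coatom is proved under the condition that m is not the greatest element of L, since the claim fails otherwise (e.g. L = {m}). *)

theory Defs
  imports "HOL-Algebra.Lattice" "HOL-Library.Disjoint_Sets"
begin

definition partition_lattice :: "'a set \<Rightarrow> 'a set set gorder"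
  where "partition_lattice S =
    \<lparr>carrier = {P. partition_on S P}, eq = (=), le = refines S\<rparr>"

lemma lattice_partition_lattice: "lattice (partition_lattice S)"
proof -
  interpret partial_order "partition_lattice S"
    by unfold_locales
      (auto simp: partition_lattice_def intro: refines_refl refines_trans dest: refines_asym)
  show ?thesis
  proof unfold_locales
    fix P Q assume "P \<in> carrier (partition_lattice S)" "Q \<in> carrier (partition_lattice S)"
    then have PQ: "partition_on S P" "partition_on S Q"
      by (auto simp: partition_lattice_def)
    show "\<exists>s. greatest (partition_lattice S) s (Lower (partition_lattice S) {P, Q})"
      using PQ partition_on_common_refinement[of "{P, Q}" S]
        refines_common_refinement[of "{P, Q}" S] common_refinement_coarsest[of "{P, Q}" S]
      by (intro exI[of _ "common_refinement {P, Q}"])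
        (auto simp: greatest_def Lower_def partition_lattice_def)
    define U where "U = {R. refines S P R \<and> refines S Q R}"
    define T where "T = (if S = {} then {} else {S})"
    have "refines S R T" if "partition_on S R" for R
      using that by (auto simp: T_def refines_def partition_on_def disjoint_def)
    then have "U \<noteq> {}"
      using PQ by (auto simp: U_def)
    moreover have U: "partition_on S R" if "R \<in> U" for R
      using that by (auto simp: U_def refines_def)
    ultimately have "refines S P (common_refinement U)" "refines S Q (common_refinement U)"
      "partition_on S (common_refinement U)"
      "\<And>R. R \<in> U \<Longrightarrow> refines S (common_refinement U) R"
      using PQ by (auto intro!: common_refinement_coarsest partition_on_common_refinement
          refines_common_refinement simp: U_def)
    then show "\<exists>s. least (partition_lattice S) s (Upper (partition_lattice S) {P, Q})"
      using PQ by (intro exI[of _ "common_refinement U"])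
        (auto simp: least_def Upper_def partition_lattice_def U_def)
  qed
qed

text \<open>The order on a subset of a poset is the induced one; joins and meets of
  \<open>induced_order P A\<close> are taken among the elements of \<open>A\<close> only, so its join may
  differ from the join of \<open>P\<close>.\<close>

definition induced_order :: "('a, 'b) gorder_scheme \<Rightarrow> 'a set \<Rightarrow> ('a, 'b) gorder_scheme"
  where "induced_order P A = P\<lparr>carrier := A\<rparr>"

definition meet_subsemilattice :: "('a, 'b) gorder_scheme \<Rightarrow> 'a set \<Rightarrow> bool"
  where "meet_subsemilattice P A \<longleftrightarrow>
    A \<subseteq> carrier P \<and> (\<forall>x\<in>A. \<forall>y\<in>A. x \<sqinter>\<^bsub>P\<^esub> y \<in> A)"

definition left_modular :: "('a, 'b) gorder_scheme \<Rightarrow> 'a \<Rightarrow> bool"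
  where "left_modular L m \<longleftrightarrow> m \<in> carrier L \<and>
    (\<forall>x\<in>carrier L. \<forall>y\<in>carrier L. x \<sqsubset>\<^bsub>L\<^esub> y \<longrightarrow>
      (x \<squnion>\<^bsub>L\<^esub> m) \<sqinter>\<^bsub>L\<^esub> y = x \<squnion>\<^bsub>L\<^esub> (m \<sqinter>\<^bsub>L\<^esub> y))"

definition coatom :: "('a, 'b) gorder_scheme \<Rightarrow> 'a \<Rightarrow> bool"
  where "coatom L m \<longleftrightarrow> m \<in> carrier L \<and> m \<sqsubset>\<^bsub>L\<^esub> \<top>\<^bsub>L\<^esub> \<and>
    \<not> (\<exists>z\<in>carrier L. m \<sqsubset>\<^bsub>L\<^esub> z \<and> z \<sqsubset>\<^bsub>L\<^esub> \<top>\<^bsub>L\<^esub>)"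

end

theory Submission
  imports Defs
begin

text \<open>The only partitions above \<open>m\<close> are \<open>m\<close> and the one-block partition. This makes \<open>m\<close> a
  coatom unless it is the top element of \<open>L\<close>, and it gives \<open>a \<squnion> m = {S}\<close>, hence
  \<open>(a \<squnion> m) \<sqinter> b = b\<close>, whenever \<open>a \<le> b\<close> and \<open>a\<close> is not below \<open>m\<close>. In that case the block of
  \<open>a\<close> containing \<open>x\<close> has a further element \<open>y\<close>. Since meets in \<open>L\<close> are meets of partitions,
  \<open>m \<sqinter> b\<close> only splits \<open>x\<close> off its block in \<open>b\<close>, so any upper bound of \<open>a\<close> and \<open>m \<sqinter> b\<close>
  reattaches \<open>x\<close> via \<open>y\<close> and lies above \<open>b\<close>.\<close>

lemma partition_on_same_block:
  assumes "partition_on S P" "X \<in> P" "Y \<in> P" "z \<in> X" "z \<in> Y"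
  shows "X = Y"
  using assms by (auto simp: partition_on_def disjoint_def)

lemma refines_one_block:
  assumes "partition_on S P" "S \<noteq> {}"
  shows "refines S P {S}"
  using assms by (auto simp: refines_def partition_on_def disjoint_def)

text \<open>Blocks of a common refinement are the nonempty intersections of one block chosen from
  each partition. If \<open>P = Q\<close>, only one block is chosen, which suffices because
  overlapping blocks coincide.\<close>

lemma Int_in_common_refinement:
  assumes "partition_on S P" "partition_on S Q" "X \<in> P" "Y \<in> Q" "X \<inter> Y \<noteq> {}"
  shows "X \<inter> Y \<in> common_refinement {P, Q}"
proof (cases "P = Q")
  case True
  then have "X = Y"
    using assms partition_on_same_block by fastforce
  then show ?thesis
    using True assms by (auto simp: common_refinement intro!: bexI[of _ "\<lambda>_. X"])
next
  case False
  then show ?thesis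
    using assms unfolding common_refinement
    by (intro DiffI UN_I[of "\<lambda>R. if R = P then X else Y"]) (simp_all add: Int_commute)
qed

text \<open>Some block \<open>X\<close> of \<open>Q\<close> contains \<open>x\<close> and some block
  \<open>Y\<close> contains the rest of \<open>S\<close>, so every block overlaps, hence equals,
  \<open>X\<close> or \<open>Y\<close>. Whether \<open>x\<close> lies in \<open>Y\<close> decides
  between the two outcomes.\<close>

lemma refined_by_singleton_split:
  assumes "refines S {{x}, S - {x}} Q"
  shows "Q = {{x}, S - {x}} \<or> Q = {S}"
proof -
  have Q: "partition_on S Q" and xS: "x \<in> S"
    using assms by (auto simp: refines_def partition_on_def)
  obtain X Y where XY: "X \<in> Q" "Y \<in> Q" "x \<in> X" "S - {x} \<subseteq> Y"
    using assms by (auto simp: refines_def)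
  have sub: "Z \<subseteq> S" "Z \<noteq> {}" if "Z \<in> Q" for Z
    using Q that by (auto simp: partition_on_def)
  have Q_eq: "Q = {X, Y}"
  proof -
    have "Z = X \<or> Z = Y" if "Z \<in> Q" for Z
      using that sub[OF that] XY partition_on_same_block[OF Q that] by blast
    then show ?thesis
      using XY by blast
  qed
  show ?thesis
  proof (cases "x \<in> Y")
    case True
    then have "X = Y" "Y = S"
      using XY sub partition_on_same_block[OF Q] by blast+
    then show ?thesis
      using Q_eq by simp
  next
    case False
    then have "Y = S - {x}"
      using XY sub by blast
    moreover have "X = {x}"
      using XY sub False partition_on_same_block[OF Q] by blast
    ultimately show ?thesis
      using Q_eq by simp
  qed
qed

lemma not_refines_singleton_split:
  assumes "partition_on S P" "partition_on S {{x}, S - {x}}"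
    and "\<not> refines S P {{x}, S - {x}}"
  obtains X y where "X \<in> P" "x \<in> X" "y \<in> X" "y \<noteq> x"
proof -
  obtain X where "X \<in> P" "\<not> X \<subseteq> {x}" "\<not> X \<subseteq> S - {x}"
    using assms by (auto simp: refines_def)
  moreover from this have "X \<subseteq> S"
    using assms(1) by (auto simp: partition_on_def)
  ultimately show thesis
    using that by blast
qed

text \<open>Applied with \<open>a\<close>, \<open>b\<close> and the join of \<open>a\<close> and
  \<open>m \<sqinter> b\<close> as \<open>P\<close>, \<open>Q\<close> and \<open>R\<close>. A block
  of \<open>P\<close> holding \<open>x\<close> and another point \<open>y\<close> lies within one
  block of \<open>Q\<close> and one of \<open>R\<close>, so \<open>y\<close> marks where
  \<open>x\<close> belongs.\<close>

lemma refines_if_singleton_split_refines: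
  assumes m: "partition_on S {{x}, S - {x}}"
    and nle: "\<not> refines S P {{x}, S - {x}}"
    and PQ: "refines S P Q" and PR: "refines S P R"
    and cR: "refines S (common_refinement {{{x}, S - {x}}, Q}) R"
  shows "refines S Q R"
proof -
  have parts: "partition_on S P" "partition_on S Q" "partition_on S R"
    using PQ PR by (auto simp: refines_def)
  obtain X y where X: "X \<in> P" "x \<in> X" "y \<in> X" "y \<noteq> x"
    using not_refines_singleton_split[OF parts(1) m nle] .
  obtain D where D: "D \<in> R" "X \<subseteq> D"
    using PR X by (auto simp: refines_def)
  obtain B where B: "B \<in> Q" "X \<subseteq> B"
    using PQ X by (auto simp: refines_def)
  have "\<exists>C\<in>R. Y \<subseteq> C" if Y: "Y \<in> Q" for Y
  proof -
    have YS: "Y \<subseteq> S" "Y \<noteq> {}"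
      using parts(2) Y by (auto simp: partition_on_def)
    have yY: "y \<in> Y" if "x \<in> Y"
      using partition_on_same_block[OF parts(2) Y B(1)] that X B by blast
    \<comment> \<open>Empty intersections are not blocks; \<open>Y = {x}\<close> is impossible since
      \<open>Y\<close> contains \<open>y\<close> whenever it contains \<open>x\<close>.\<close>
    have "(S - {x}) \<inter> Y \<noteq> {}"
      using YS yY X by blast
    then have "(S - {x}) \<inter> Y \<in> common_refinement {{{x}, S - {x}}, Q}"
      using Int_in_common_refinement[OF m parts(2) _ Y] by blast
    then obtain C where C: "C \<in> R" "(S - {x}) \<inter> Y \<subseteq> C"
      using cR unfolding refines_def by blast
    have "Y \<subseteq> C"
    proof (cases "x \<in> Y")
      case True
      then have "y \<in> C"
        using yY C YS X by blast
      \<comment> \<open>Both blocks of \<open>R\<close> contain \<open>y\<close>, and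
        \<open>D\<close> also contains \<open>x\<close>.\<close>
      then have "C = D"
        using partition_on_same_block[OF parts(3) C(1) D(1)] D X by blast
      then show ?thesis
        using C D X YS by blast
    next
      case False
      then show ?thesis
        using C YS by blast
    qed
    then show ?thesis
      using C by blast
  qed
  then show ?thesis
    using parts by (auto simp: refines_def)
qed

lemma common_refinement_refines_meet:
  assumes "partition_on S P" "partition_on S Q"
  shows "refines S (common_refinement {P, Q}) (P \<sqinter>\<^bsub>partition_lattice S\<^esub> Q)"
proof -
  interpret lattice "partition_lattice S"
    by (rule lattice_partition_lattice)
  have "common_refinement {P, Q} \<sqsubseteq>\<^bsub>partition_lattice S\<^esub> P \<sqinter>\<^bsub>partition_lattice S\<^esub> Q"
    using assms partition_on_common_refinement[of "{P, Q}" S]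
      refines_common_refinement[of "{P, Q}" S]
    by (intro meet_le) (auto simp: partition_lattice_def)
  then show ?thesis
    by (simp add: partition_lattice_def)
qed

text \<open>Closure puts the meet of \<open>P\<close> into \<open>A\<close>, where it is a lower
  bound of \<open>a\<close> and \<open>b\<close>, hence below their greatest lower bound in
  \<open>A\<close>.\<close>

lemma meet_le_meet_induced_order:
  assumes "lattice P" "meet_subsemilattice P A" "lattice (induced_order P A)"
    and ab: "a \<in> A" "b \<in> A"
  shows "a \<sqinter>\<^bsub>P\<^esub> b \<sqsubseteq>\<^bsub>P\<^esub> a \<sqinter>\<^bsub>induced_order P A\<^esub> b"
proof -
  interpret P: lattice P by fact
  interpret I: lattice "induced_order P A" by fact
  have [simp]: "carrier (induced_order P A) = A"
    "c \<sqsubseteq>\<^bsub>induced_order P A\<^esub> d \<longleftrightarrow> c \<sqsubseteq>\<^bsub>P\<^esub> d" for c d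
    by (simp_all add: induced_order_def)
  have "a \<in> carrier P" "b \<in> carrier P" "a \<sqinter>\<^bsub>P\<^esub> b \<in> A"
    using assms by (auto simp: meet_subsemilattice_def)
  then have "a \<sqinter>\<^bsub>P\<^esub> b \<sqsubseteq>\<^bsub>induced_order P A\<^esub> a \<sqinter>\<^bsub>induced_order P A\<^esub> b"
    using ab by (intro I.meet_le) (simp_all add: P.meet_left P.meet_right)
  then show ?thesis
    by simp
qed

theorem theorem4p2:
  fixes S :: "'a set" and L :: "'a set set set" and x :: 'a and m :: "'a set set"
  assumes "finite S"
    and "meet_subsemilattice (partition_lattice S) L"
    and "lattice (induced_order (partition_lattice S) L)"
    and "x \<in> S"
    and "m = {{x}, S - {x}}"
    and "m \<in> L"
  shows "left_modular (induced_order (partition_lattice S) L) m \<and>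
    (m \<noteq> \<top>\<^bsub>induced_order (partition_lattice S) L\<^esub> \<longrightarrow>
      coatom (induced_order (partition_lattice S) L) m)"
proof -
  define I where "I = induced_order (partition_lattice S) L"
  interpret I: lattice I
    unfolding I_def by fact
  have carr [simp]: "carrier I = L"
    and le [simp]: "\<And>P Q. P \<sqsubseteq>\<^bsub>I\<^esub> Q \<longleftrightarrow> refines S P Q"
    and eq [simp]: "\<And>P Q. P .=\<^bsub>I\<^esub> Q \<longleftrightarrow> P = Q"
    by (simp_all add: I_def induced_order_def partition_lattice_def)
  have part: "partition_on S P" if "P \<in> L" for P
    using assms(2) that by (auto simp: meet_subsemilattice_def partition_lattice_def)
  have m_part: "partition_on S {{x}, S - {x}}"
    using part assms(5,6) by simp
  have above_m: "Q = m \<or> Q = {S}" if "refines S m Q" for Q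
    using refined_by_singleton_split that assms(5) by metis
  have le_one: "refines S P {S}" if "P \<in> L" for P
    using refines_one_block part[OF that] assms(4) by blast

  have mod: "(a \<squnion>\<^bsub>I\<^esub> m) \<sqinter>\<^bsub>I\<^esub> b = a \<squnion>\<^bsub>I\<^esub> (m \<sqinter>\<^bsub>I\<^esub> b)"
    if a: "a \<in> L" and b: "b \<in> L" and ab: "refines S a b" for a b
  proof (cases "refines S a m")
    \<comment> \<open>Both sides collapse to \<open>m \<sqinter> b\<close>.\<close>
    case True
    have "a \<squnion>\<^bsub>I\<^esub> m = m"
      using I.le_iff_meet[of a m] True a assms(6) by simp
    moreover have "refines S a (m \<sqinter>\<^bsub>I\<^esub> b)"
      using I.meet_le[of a m b] True ab a b assms(6) by simp
    then have "a \<squnion>\<^bsub>I\<^esub> (m \<sqinter>\<^bsub>I\<^esub> b) = m \<sqinter>\<^bsub>I\<^esub> b"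
      using I.le_iff_meet[of a "m \<sqinter>\<^bsub>I\<^esub> b"] I.meet_closed[of m b] a b assms(6) by simp
    ultimately show ?thesis
      by simp
  next
    case False
    define c where "c = a \<squnion>\<^bsub>I\<^esub> (m \<sqinter>\<^bsub>I\<^esub> b)"
    have mb: "m \<sqinter>\<^bsub>I\<^esub> b \<in> L" "refines S (m \<sqinter>\<^bsub>I\<^esub> b) b"
      using I.meet_closed[of m b] I.meet_right[of m b] b assms(6) by simp_all
    have c: "c \<in> L" "refines S a c" "refines S (m \<sqinter>\<^bsub>I\<^esub> b) c" "refines S c b"
      using I.join_closed[of a "m \<sqinter>\<^bsub>I\<^esub> b"] I.join_left[of a "m \<sqinter>\<^bsub>I\<^esub> b"]
        I.join_right[of a "m \<sqinter>\<^bsub>I\<^esub> b"] I.join_le[of a b "m \<sqinter>\<^bsub>I\<^esub> b"] mb a b ab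
      by (simp_all add: c_def)
    \<comment> \<open>The chain is: common refinement, meet in the partition lattice, meet in
      \<open>L\<close>, then \<open>c\<close>.\<close>
    have "refines S (m \<sqinter>\<^bsub>partition_lattice S\<^esub> b) (m \<sqinter>\<^bsub>I\<^esub> b)"
      using meet_le_meet_induced_order[OF lattice_partition_lattice assms(2,3,6) b]
      by (simp add: I_def partition_lattice_def)
    then have "refines S (common_refinement {m, b}) c"
      using common_refinement_refines_meet[OF part[OF assms(6)] part[OF b]] c(3)
      by (blast intro: refines_trans)
    then have "refines S b c"
      using refines_if_singleton_split_refines[OF m_part _ ab c(2)] False assms(5) by simp
    then have "c = b"
      using c(4) by (rule refines_asym[rotated])
    moreover have "(a \<squnion>\<^bsub>I\<^esub> m) \<sqinter>\<^bsub>I\<^esub> b = b"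
    proof -
      have j: "a \<squnion>\<^bsub>I\<^esub> m \<in> L" "refines S a (a \<squnion>\<^bsub>I\<^esub> m)" "refines S m (a \<squnion>\<^bsub>I\<^esub> m)"
        using I.join_closed[of a m] I.join_left[of a m] I.join_right[of a m] a assms(6)
        by simp_all
      \<comment> \<open>The join is above \<open>m\<close> but differs from \<open>m\<close>, since
        \<open>a\<close> is not below \<open>m\<close>.\<close>
      then have "a \<squnion>\<^bsub>I\<^esub> m = {S}"
        using above_m False by metis
      then show ?thesis
        using I.le_iff_join[of b "{S}"] le_one[OF b] j(1) b by (simp add: meet_comm)
    qed
    ultimately show ?thesis
      by (simp add: c_def)
  qed
  then have "left_modular I m"
    using assms(6) by (auto simp: left_modular_def lless_def)
  moreover have "coatom I m" if ne: "m \<noteq> \<top>\<^bsub>I\<^esub>"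
  proof -
    \<comment> \<open>The top is defined by choice, so it is known only once some greatest element
      has been exhibited.\<close>
    have top_eq: "\<top>\<^bsub>I\<^esub> = t" if "greatest I t L" for t
      using that I.greatest_unique unfolding top_def carr by (metis someI)
    \<comment> \<open>Otherwise each join \<open>P \<squnion> m\<close> must be \<open>m\<close>
      itself, making \<open>m\<close> the top of \<open>L\<close>.\<close>
    have "{S} \<in> L"
    proof (rule ccontr)
      assume "{S} \<notin> L"
      then have "refines S P m" if "P \<in> L" for P
        using above_m[of "P \<squnion>\<^bsub>I\<^esub> m"] I.join_closed[of P m] I.join_left[of P m]
          I.join_right[of P m] that assms(6) by auto
      then have "greatest I m L"
        using assms(6) by (simp add: greatest_def)
      then show False
        using top_eq ne by simp
    qed
    then have "\<top>\<^bsub>I\<^esub> = {S}"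
      using le_one by (intro top_eq) (simp add: greatest_def)
    then show ?thesis
      using ne assms(6) le_one above_m by (auto simp: coatom_def lless_def)
  qed
  ultimately show ?thesis
    by (simp add: I_def)
qed

end
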